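(* Let $\mathbb K=\mathbb R$ or $\mathbb C$, let $X$ be a $d$-dimensional Banach space over $\mathbb K$ (with $d\ge 1$), and let $P_1,\ldots,P_n:X\to\mathbb K$ be polynomials of degrees $k_1,\ldots,k_n\geq 1$. Then $$\|P_1\|\cdots\|P_n\|\leq \frac{(C_{\mathbb K}\,4ed)^{\sum_{i=1}^n k_i}}{2^{n/C_{\mathbb K}}}\,\|P_1\cdots P_n\|,$$ where $C_{\mathbb R}=1$ and $C_{\mathbb C}=2$.
   Context: $B_X$ denotes the unit ball of $X$. A function $P:X\to\mathbb K$ is a continuous $k$-homogeneous polynomial if there is a continuous $k$-linear function $T:X\times\cdots\times X\to\mathbb K$ with $P(z)=T(z,\ldots,z)$. A function $Q:X\to\mathbb K$ is a continuous polynomial of degree $k$ if $Q=\sum_{l=0}^k Q_l$ with $Q_0$ constant, $Q_l$ a continuous $l$-homogeneous polynomial for $1\le l\le k$, and $Q_k\neq 0$. The norm of a polynomial is $\|Q\|=\sup_{z\in B_X}|Q(z)|$. Products of polynomials are pointwise. Here $e$ is the base of the natural logarithm. *)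

theory Defs
  imports "HOL-Analysis.Analysis"
begin

text \<open>
  A complex Banach space is a Banach space type (library class \<open>banach\<close>, which carries the norm,
  the topology and completeness) together with a complex scalar multiplication that extends the
  real one of the type class and for which the norm is homogeneous.
\<close>

locale complex_banach_space = vector_space smul
  for smul :: "complex \<Rightarrow> 'a::banach \<Rightarrow> 'a" +
  assumes scale_of_real: "smul (of_real r) x = r *\<^sub>R x"
    and norm_scale: "norm (smul c x) = norm c * norm x"

text \<open>
  The \<open>l\<close>-fold product of \<open>X\<close> is the set of extensional functions on \<open>{..<l}\<close>, with the product
  topology. The field of scalars is the type \<open>'k\<close>, used below only for \<open>real\<close> and \<open>complex\<close>.
\<close>

definition continuous_multilinear ::
  "('k::real_normed_field \<Rightarrow> 'a::real_normed_vector \<Rightarrow> 'a) \<Rightarrow> nat \<Rightarrow> ((nat \<Rightarrow> 'a) \<Rightarrow> 'k) \<Rightarrow> bool"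
  where "continuous_multilinear smul l T \<longleftrightarrow>
    continuous_map (product_topology (\<lambda>_. euclidean) {..<l}) euclidean T \<and>
    (\<forall>i<l. \<forall>x \<in> {..<l} \<rightarrow>\<^sub>E UNIV. Vector_Spaces.linear smul (*) (\<lambda>v. T (x(i := v))))"

definition homogeneous_polynomial ::
  "('k::real_normed_field \<Rightarrow> 'a::real_normed_vector \<Rightarrow> 'a) \<Rightarrow> nat \<Rightarrow> ('a \<Rightarrow> 'k) \<Rightarrow> bool"
  where "homogeneous_polynomial smul l P \<longleftrightarrow>
    (\<exists>T. continuous_multilinear smul l T \<and> (\<forall>z. P z = T (\<lambda>i\<in>{..<l}. z)))"

definition polynomial_of_degree ::
  "('k::real_normed_field \<Rightarrow> 'a::real_normed_vector \<Rightarrow> 'a) \<Rightarrow> nat \<Rightarrow> ('a \<Rightarrow> 'k) \<Rightarrow> bool"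
  where "polynomial_of_degree smul k P \<longleftrightarrow>
    (\<exists>Q. (\<exists>c. \<forall>z. Q 0 z = c) \<and>
         (\<forall>l\<in>{1..k}. homogeneous_polynomial smul l (Q l)) \<and>
         (\<exists>z. Q k z \<noteq> 0) \<and>
         (\<forall>z. P z = (\<Sum>l=0..k. Q l z)))"

definition poly_norm :: "('a::real_normed_vector \<Rightarrow> 'k::real_normed_field) \<Rightarrow> real"
  where "poly_norm P = (SUP z\<in>cball 0 1. norm (P z))"

end

theory Submission
  imports Defs "HOL-Real_Asymp.Real_Asymp" "HOL-Computational_Algebra.Fundamental_Theorem_Algebra"
begin

text \<open>
  The idea is to average the logarithm of the product over the unit ball. Let \<open>D\<close> be the real
  dimension of the space, \<open>B\<close> its unit ball and \<open>\<mu>\<close> Lebesgue measure in some linear coordinates.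
  For every polynomial \<open>F\<close> of degree at most \<open>k\<close>, with maximum \<open>M > 0\<close> of \<open>|F|\<close> on \<open>B\<close>,

    \<open>\<integral>\<^sub>B max 0 (- ln (|F| / M)) d\<mu> \<le> k (1 + ln (2 D)) \<mu>(B)\<close>   (lemma \<open>integral_neg_ln_line_polynomial_le\<close>).

  The right-hand side does not depend on where the maximum is attained, so these bounds can be
  added up for \<open>F = P\<^sub>1, \<dots>, P\<^sub>n\<close>, and some point of \<open>B\<close> satisfies
  \<open>\<Sum>\<^sub>i - ln (|P\<^sub>i| / \<parallel>P\<^sub>i\<parallel>) \<le> (\<Sum>\<^sub>i k\<^sub>i) (1 + ln (2 D))\<close>. Exponentiating,

    \<open>\<Prod>\<^sub>i \<parallel>P\<^sub>i\<parallel> \<le> (2 e D) ^ (\<Sum>\<^sub>i k\<^sub>i) \<parallel>\<Prod>\<^sub>i P\<^sub>i\<parallel>\<close>   (lemma \<open>prod_poly_norm_le\<close>).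

  As \<open>\<Sum>\<^sub>i k\<^sub>i \<ge> n\<close>, a factor \<open>2 ^ (\<Sum>\<^sub>i k\<^sub>i)\<close> may be traded for \<open>2 ^ n\<close>. This gives the real
  inequality with \<open>D = d\<close>, and the complex one with \<open>D \<le> 2 d\<close>.

  The logarithmic integral is estimated in polar coordinates around a point \<open>x\<^sub>0\<close> of \<open>B\<close> with
  \<open>|F x\<^sub>0| = M\<close>. On a ray \<open>x\<^sub>0 + s v\<close> the function \<open>F\<close> is a polynomial in \<open>s\<close> of degree at most \<open>k\<close>, so
  \<open>F (x\<^sub>0 + s v) / F x\<^sub>0\<close> is a product of at most \<open>k\<close> factors \<open>1 - s w\<close> with \<open>w\<close> complex. By
  subadditivity only \<open>\<integral>\<^sub>0\<^sup>1 s ^ (D - 1) max 0 (- ln |1 - s w|) ds\<close> has to be estimated, and it is at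
  most \<open>(1 + ln (2 D)) / D\<close> (lemma \<open>radial_neg_ln_linear_factor\<close>). Only two properties of
  polynomials enter: continuity, and being a polynomial of degree at most \<open>k\<close> on every real line.
\<close>

section \<open>The negative part of the logarithm\<close>

text \<open>
  The function \<open>max 0 (- ln u)\<close>, continued by \<open>\<infinity>\<close> for \<open>u \<le> 0\<close>; with the library convention
  \<open>ln 0 = 0\<close> a zero would count as a maximum. Truncating at \<open>0\<close> keeps all integrals below
  nonnegative, so that no integrability has to be shown.
\<close>

definition neg_ln :: "real \<Rightarrow> ennreal"
  where "neg_ln u = (if u \<le> 0 then \<infinity> else ennreal (- ln u))"

lemma neg_ln_measurable [measurable]: "neg_ln \<in> borel_measurable borel"
  unfolding neg_ln_def by measurable

lemma neg_ln_antimono: "u \<le> v \<Longrightarrow> neg_ln v \<le> neg_ln u"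
  by (auto simp: neg_ln_def intro!: ennreal_leI)

lemma neg_ln_eq_0: "u \<ge> 1 \<Longrightarrow> neg_ln u = 0"
  by (auto simp: neg_ln_def ennreal_eq_0_iff)

lemma neg_ln_mult_le: 
  assumes "u \<ge> 0" "v \<ge> 0"
  shows "neg_ln (u * v) \<le> neg_ln u + neg_ln v"
proof (cases "u = 0 \<or> v = 0")
  case True
  then show ?thesis by (auto simp: neg_ln_def)
next
  case False
  have "ennreal (- ln u - ln v) \<le> ennreal (max 0 (- ln u) + max 0 (- ln v))"
    by (intro ennreal_leI) linarith
  also have "\<dots> = ennreal (- ln u) + ennreal (- ln v)"
    by (subst ennreal_plus) (auto simp: max_def ennreal_neg)
  finally show ?thesis
    using False assms by (auto simp: neg_ln_def ln_mult mult_le_0_iff)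
qed

lemma neg_ln_prod_le:
  assumes "\<And>i. i \<in> A \<Longrightarrow> u i \<ge> 0"
  shows "neg_ln (\<Prod>i\<in>A. u i) \<le> (\<Sum>i\<in>A. neg_ln (u i))"
  using assms
proof (induction A rule: infinite_finite_induct)
  case (insert i A)
  have "neg_ln (\<Prod>i\<in>insert i A. u i) \<le> neg_ln (u i) + neg_ln (\<Prod>i\<in>A. u i)"
    using insert by (auto intro!: neg_ln_mult_le prod_nonneg)
  also have "\<dots> \<le> neg_ln (u i) + (\<Sum>i\<in>A. neg_ln (u i))"
    using insert by (intro add_left_mono) auto
  finally show ?case using insert by simp
qed (auto simp: neg_ln_eq_0)

text \<open>
  The primitive \<open>v - v ln v\<close> extends continuously to \<open>0\<close>, so the fundamental theorem of calculus
  applies on the whole closed interval although the integrand is unbounded.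
\<close>

lemma neg_ln_unit_integral: "(\<integral>\<^sup>+v\<in>{0..1}. neg_ln v \<partial>lborel) = 1"
proof -
  have "((\<lambda>v. - ln v) has_integral ((1 - 1 * ln 1) - (0 - 0 * ln (0::real)))) {0..1}"
  proof (rule fundamental_theorem_of_calculus_interior)
    show "continuous_on {0..1} (\<lambda>v::real. v - v * ln v)"
    proof -
      have "isCont (\<lambda>v::real. v - v * ln v) v" if "v > 0" for v
        using that by (intro continuous_intros) auto
      moreover have "((\<lambda>v::real. v - v * ln v) \<longlongrightarrow> 0 - 0 * ln 0) (at 0 within {0..1})"
      proof -
        have "((\<lambda>v::real. v - v * ln v) \<longlongrightarrow> 0) (at_right 0)"
          by real_asymp
        then show ?thesis by (simp add: at_within_Icc_at_right)
      qed
      ultimately show ?thesis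
        unfolding continuous_on_def
        by (metis (no_types, lifting) atLeastAtMost_iff continuous_at_imp_continuous_at_within continuous_within order_le_less)
    qed
  qed (auto intro!: derivative_eq_intros simp flip: has_real_derivative_iff_has_vector_derivative)
  then have "((\<lambda>v. - ln v) has_integral 1) {0..1::real}" by simp
  then have "(\<integral>\<^sup>+v. ennreal (- ln v) * indicator {0..1} v \<partial>lborel) = 1"
    by (subst nn_integral_has_integral_lebesgue') (auto simp: ln_le_zero_iff order_le_less)
  moreover have "AE v in lborel. neg_ln v * indicator {0..1} v = ennreal (- ln v) * indicator {0..1} v"
    using AE_lborel_singleton[of "0::real"]
    by eventually_elim (auto simp: neg_ln_def indicator_def)
  ultimately show ?thesis using nn_integral_cong_AE by metis
qed

lemma neg_ln_abs_integral_le: "(\<integral>\<^sup>+v. neg_ln \<bar>v\<bar> \<partial>lborel) \<le> 2"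
proof -
  let ?g = "\<lambda>v::real. neg_ln v * indicator {0..1} v"
  have "neg_ln \<bar>v\<bar> \<le> ?g v + ?g (0 + (-1) * v)" for v
    by (cases "\<bar>v\<bar> \<ge> 1") (auto simp: neg_ln_eq_0 indicator_def abs_if)
  then have "(\<integral>\<^sup>+v. neg_ln \<bar>v\<bar> \<partial>lborel) \<le> (\<integral>\<^sup>+v. ?g v + ?g (0 + (-1) * v) \<partial>lborel)"
    by (intro nn_integral_mono) auto
  also have "\<dots> = (\<integral>\<^sup>+v. ?g v \<partial>lborel) + (\<integral>\<^sup>+v. ?g (0 + (-1) * v) \<partial>lborel)"
    by (intro nn_integral_add) measurable
  also have "(\<integral>\<^sup>+v. ?g (0 + (-1) * v) \<partial>lborel) = (\<integral>\<^sup>+v. ?g v \<partial>lborel)"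
    by (subst (2) nn_integral_real_affine[where c = "-1" and t = 0]) auto
  finally show ?thesis
    by (simp add: neg_ln_unit_integral)
qed

section \<open>Radial logarithmic integrals of complex polynomials\<close>

lemma power_moment:
  assumes "d \<ge> 1"
  shows "(\<integral>\<^sup>+s\<in>{0<..<1}. ennreal (s ^ (d - 1)) \<partial>lborel) = ennreal (1 / d)"
proof -
  have "(\<integral>\<^sup>+s\<in>{0..1}. ennreal (s ^ (d - 1)) \<partial>lborel) = ennreal (1 ^ d / d - 0 ^ d / d)"
  proof (rule nn_integral_FTC_Icc)
    show "((\<lambda>s. s ^ d / d) has_real_derivative s ^ (d - 1)) (at s)" for s :: real
      using assms by (auto intro!: derivative_eq_intros)
  qed auto
  moreover have "(\<integral>\<^sup>+s\<in>{0<..<1}. ennreal (s ^ (d - 1)) \<partial>lborel) = (\<integral>\<^sup>+s\<in>{0..1}. ennreal (s ^ (d - 1)) \<partial>lborel)"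
    using AE_lborel_singleton[of "0::real"] AE_lborel_singleton[of "1::real"]
    by (intro nn_integral_cong_AE, eventually_elim) (auto simp: indicator_def)
  ultimately show ?thesis using assms by (simp add: power_0_left)
qed

text \<open>
  This estimate is the source of the constant \<open>2 e d\<close>. Passing from \<open>w\<close> to its real part decreases
  \<open>|1 - s w|\<close>. If \<open>Re w < 1\<close> then moreover \<open>1 - s Re w \<ge> 1 - s\<close>, so \<open>w\<close> may be replaced by the real
  number \<open>a = max 1 (Re w)\<close>. With \<open>c = 2 d\<close>, split \<open>- ln |1 - s a|\<close> into \<open>ln c\<close> and
  \<open>- ln (c |1 - s a|)\<close>. The first part contributes \<open>ln c / d\<close>. In the second the weight
  \<open>s ^ (d - 1)\<close> is bounded by \<open>1\<close>, and substituting \<open>v = c (1 - s a)\<close> yields at most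
  \<open>2 / (c a) \<le> 1 / d\<close>; the choice of \<open>c\<close> minimizes the sum of \<open>ln c / d\<close> and \<open>2 / c\<close>.
\<close>

lemma radial_neg_ln_linear_factor:
  assumes "d \<ge> 1"
  shows "(\<integral>\<^sup>+s\<in>{0<..<1}. ennreal (s ^ (d - 1)) * neg_ln (cmod (1 - of_real s * w)) \<partial>lborel)
          \<le> ennreal ((1 + ln (2 * real d)) / d)"
proof -
  define a where "a = max 1 (Re w)"
  define c :: real where "c = 2 * d"
  have c: "c \<ge> 1" "a \<ge> 1" using assms by (auto simp: c_def a_def)
  have pointwise: "ennreal (s ^ (d - 1)) * neg_ln (cmod (1 - of_real s * w))
      \<le> ennreal (s ^ (d - 1)) * ennreal (ln c) + neg_ln \<bar>c + (- (c * a)) * s\<bar>" if s: "0 < s" "s < 1" for s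
  proof -
    have "\<bar>1 - s * a\<bar> \<le> \<bar>Re (1 - of_real s * w)\<bar>"
    proof (cases "Re w \<le> 1")
      case True
      then have "s * Re w \<le> s" using s by (simp add: mult_left_le)
      moreover have "\<bar>1 - s * a\<bar> = 1 - s" using True s by (simp add: a_def)
      moreover have "1 - s * Re w \<le> \<bar>Re (1 - of_real s * w)\<bar>" by simp
      ultimately show ?thesis by linarith
    qed (simp add: a_def)
    also have "\<dots> \<le> cmod (1 - of_real s * w)" by (rule abs_Re_le_cmod)
    finally have "neg_ln (cmod (1 - of_real s * w)) \<le> neg_ln \<bar>1 - s * a\<bar>"
      by (rule neg_ln_antimono)
    also have "\<bar>1 - s * a\<bar> = 1 / c * \<bar>c + (- (c * a)) * s\<bar>"
    proof -
      have "c + (- (c * a)) * s = c * (1 - s * a)" by (simp add: algebra_simps)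
      then show ?thesis using c by (simp add: abs_mult)
    qed
    also have "neg_ln (1 / c * \<bar>c + (- (c * a)) * s\<bar>) \<le> neg_ln (1 / c) + neg_ln \<bar>c + (- (c * a)) * s\<bar>"
      using c by (intro neg_ln_mult_le) auto
    also have "neg_ln (1 / c) = ennreal (ln c)"
      using c by (auto simp: neg_ln_def ln_div)
    finally have "ennreal (s ^ (d - 1)) * neg_ln (cmod (1 - of_real s * w))
       \<le> ennreal (s ^ (d - 1)) * (ennreal (ln c) + neg_ln \<bar>c + (- (c * a)) * s\<bar>)"
      by (intro mult_left_mono) auto
    also have "\<dots> = ennreal (s ^ (d - 1)) * ennreal (ln c) + ennreal (s ^ (d - 1)) * neg_ln \<bar>c + (- (c * a)) * s\<bar>"
      by (simp add: distrib_left)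
    also have "ennreal (s ^ (d - 1)) * neg_ln \<bar>c + (- (c * a)) * s\<bar> \<le> 1 * neg_ln \<bar>c + (- (c * a)) * s\<bar>"
      using s by (intro mult_right_mono) (auto simp: ennreal_le_1 power_le_one)
    finally show ?thesis by simp
  qed
  have int: "(\<integral>\<^sup>+s. neg_ln \<bar>c + (- (c * a)) * s\<bar> \<partial>lborel) \<le> ennreal (1 / d)"
  proof -
    have "ennreal (c * a) * (\<integral>\<^sup>+s. neg_ln \<bar>c + (- (c * a)) * s\<bar> \<partial>lborel) = (\<integral>\<^sup>+v. neg_ln \<bar>v\<bar> \<partial>lborel)"
      using c by (subst nn_integral_real_affine[where c = "- (c * a)" and t = c and f = "\<lambda>v. neg_ln \<bar>v\<bar>"]) auto
    also have "\<dots> \<le> 2" by (rule neg_ln_abs_integral_le)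
    finally have *: "ennreal (c * a) * (\<integral>\<^sup>+s. neg_ln \<bar>c + (- (c * a)) * s\<bar> \<partial>lborel) \<le> 2" .
    have "(\<integral>\<^sup>+s. neg_ln \<bar>c + (- (c * a)) * s\<bar> \<partial>lborel)
      = ennreal (1 / (c * a)) * (ennreal (c * a) * (\<integral>\<^sup>+s. neg_ln \<bar>c + (- (c * a)) * s\<bar> \<partial>lborel))"
      using c by (simp add: mult.assoc[symmetric] ennreal_mult''[symmetric])
    also have "\<dots> \<le> ennreal (1 / (c * a)) * ennreal 2"
      using * by (intro mult_left_mono) auto
    also have "\<dots> = ennreal (2 / (c * a))"
      using c by (simp add: ennreal_mult''[symmetric] del: ennreal_numeral)
    also have "\<dots> \<le> ennreal (1 / d)"
      using c assms by (intro ennreal_leI) (auto simp: c_def field_simps)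
    finally show ?thesis .
  qed
  have "(\<integral>\<^sup>+s\<in>{0<..<1}. ennreal (s ^ (d - 1)) * neg_ln (cmod (1 - of_real s * w)) \<partial>lborel)
     \<le> (\<integral>\<^sup>+s. ennreal (ln c) * (ennreal (s ^ (d - 1)) * indicator {0<..<1} s) + neg_ln \<bar>c + (- (c * a)) * s\<bar> \<partial>lborel)"
    using pointwise by (intro nn_integral_mono) (auto simp: indicator_def mult.commute)
  also have "\<dots> = ennreal (ln c) * ennreal (1 / d) + (\<integral>\<^sup>+s. neg_ln \<bar>c + (- (c * a)) * s\<bar> \<partial>lborel)"
    using assms by (subst nn_integral_add) (auto simp: nn_integral_cmult power_moment[OF assms, simplified])
  also have "\<dots> \<le> ennreal (ln c) * ennreal (1 / d) + ennreal (1 / d)"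
    using int by (intro add_left_mono)
  also have "\<dots> = ennreal (ln c * (1 / d) + 1 / d)"
    using c by (simp add: ennreal_mult''[symmetric] flip: ennreal_plus)
  also have "ln c * (1 / d) + 1 / d = (1 + ln (2 * real d)) / d"
    by (simp add: c_def add_divide_distrib)
  finally show ?thesis .
qed

lemma poly_real_line_measurable [measurable]: "(\<lambda>s. poly (q :: complex poly) (complex_of_real s)) \<in> borel_measurable borel"
  by (intro borel_measurable_continuous_onI continuous_intros)

text \<open>
  Splitting off one complex root \<open>z\<close> at a time: \<open>z \<noteq> 0\<close> because the value at \<open>0\<close> does not vanish,
  and the quotient \<open>q(s) / q(0)\<close> then acquires the factor \<open>1 - s / z\<close>.
\<close>

lemma radial_neg_ln_poly:
  fixes q :: "complex poly"
  assumes "d \<ge> 1" "poly q 0 \<noteq> 0" "degree q \<le> k"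
  shows "(\<integral>\<^sup>+s\<in>{0<..<1}. ennreal (s ^ (d - 1)) * neg_ln (cmod (poly q (of_real s)) / cmod (poly q 0)) \<partial>lborel)
          \<le> ennreal (k * ((1 + ln (2 * real d)) / d))"
  using assms(2,3)
proof (induction k arbitrary: q)
  case 0
  then obtain c where "q = [:c:]" using degree_eq_zeroE by blast
  with 0 show ?case by (simp add: neg_ln_eq_0)
next
  case (Suc k)
  show ?case
  proof (cases "degree q = 0")
    case True
    then obtain c where "q = [:c:]" using degree_eq_zeroE by blast
    with Suc show ?thesis by (simp add: neg_ln_eq_0)
  next
    case False
    then have "\<not> constant (poly q)" by (simp add: Fundamental_Theorem_Algebra.constant_degree)
    then obtain z where "poly q z = 0" using Fundamental_Theorem_Algebra.fundamental_theorem_of_algebra by blast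
    then obtain r where q: "q = [:- z, 1:] * r" by (auto simp: poly_eq_0_iff_dvd dvd_def)
    with Suc.prems have nz: "z \<noteq> 0" "poly r 0 \<noteq> 0" by auto
    then have "r \<noteq> 0" by auto
    then have "degree q = Suc (degree r)" unfolding q by (subst degree_mult_eq) auto
    with Suc.prems have "degree r \<le> k" by simp
    have "cmod (poly q (of_real s)) / cmod (poly q 0)
       = cmod (1 - of_real s * (1 / z)) * (cmod (poly r (of_real s)) / cmod (poly r 0))" for s
    proof -
      have "cmod (1 - of_real s * (1 / z)) = cmod (of_real s - z) / cmod z"
        using nz by (simp add: norm_minus_commute field_simps flip: norm_divide)
      moreover have "poly q (of_real s) = (of_real s - z) * poly r (of_real s)" "poly q 0 = - z * poly r 0"
        by (simp_all add: q algebra_simps)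
      ultimately show ?thesis by (simp add: norm_mult)
    qed
    then have "neg_ln (cmod (poly q (of_real s)) / cmod (poly q 0))
        \<le> neg_ln (cmod (1 - of_real s * (1 / z))) + neg_ln (cmod (poly r (of_real s)) / cmod (poly r 0))" for s
      by (metis neg_ln_mult_le norm_ge_zero divide_nonneg_nonneg)
    then have "(\<integral>\<^sup>+s\<in>{0<..<1}. ennreal (s ^ (d - 1)) * neg_ln (cmod (poly q (of_real s)) / cmod (poly q 0)) \<partial>lborel)
      \<le> (\<integral>\<^sup>+s. ennreal (s ^ (d - 1)) * neg_ln (cmod (1 - of_real s * (1 / z))) * indicator {0<..<1} s
           + ennreal (s ^ (d - 1)) * neg_ln (cmod (poly r (of_real s)) / cmod (poly r 0)) * indicator {0<..<1} s \<partial>lborel)"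
      by (intro nn_integral_mono)
         (auto simp: indicator_def simp flip: distrib_left intro!: mult_left_mono)
    also have "\<dots> \<le> ennreal ((1 + ln (2 * real d)) / d) + ennreal (k * ((1 + ln (2 * real d)) / d))"
      using radial_neg_ln_linear_factor[OF assms(1), of "1 / z"] Suc.IH[OF nz(2) \<open>degree r \<le> k\<close>]
      by (subst nn_integral_add) (auto intro!: add_mono)
    also have "\<dots> = ennreal ((1 + ln (2 * real d)) / d + k * ((1 + ln (2 * real d)) / d))"
      using assms by (intro ennreal_plus[symmetric]) auto
    also have "(1 + ln (2 * real d)) / d + k * ((1 + ln (2 * real d)) / d) = Suc k * ((1 + ln (2 * real d)) / d)"
      unfolding of_nat_Suc distrib_right by simp
    finally show ?thesis .
  qed
qed

section \<open>Integration along rays of a star-shaped set\<close>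

lemma nn_integral_lborel_affine:
  fixes f :: "'e::euclidean_space \<Rightarrow> ennreal"
  assumes [measurable]: "f \<in> borel_measurable borel" and c: "c \<noteq> 0"
  shows "(\<integral>\<^sup>+x. f x \<partial>lborel) = ennreal (\<bar>c\<bar> ^ DIM('e)) * (\<integral>\<^sup>+x. f (t + c *\<^sub>R x) \<partial>lborel)"
  by (subst lborel_affine[OF c, of t])
     (simp add: nn_integral_density nn_integral_distr nn_integral_cmult)

text \<open>
  On the ray through \<open>y\<close> the set \<open>K\<close> is an interval starting at \<open>0\<close>. Hence \<open>y / s\<close> lies in the shell
  \<open>b K - K\<close> when \<open>s\<close> runs through \<open>(r / b, r)\<close>, where \<open>r \<le> 1\<close> is the gauge of \<open>K\<close> at \<open>y\<close>, and the
  \<open>ds / s\<close>-measure of this interval is \<open>ln b\<close>, whatever \<open>y\<close> is. So the scale-invariant measure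
  \<open>ds / s\<close> weighs all points of \<open>K\<close> equally.
\<close>

lemma log_shell_integral_ge:
  fixes K :: "'e::euclidean_space set"
  assumes [measurable]: "K \<in> sets borel" and K: "bounded K"
    and star: "\<And>x s. x \<in> K \<Longrightarrow> 0 < s \<Longrightarrow> s < 1 \<Longrightarrow> s *\<^sub>R x \<in> K"
    and b: "b > 1" and y: "y \<in> K" "y \<noteq> 0"
  shows "ennreal (ln b) \<le> (\<integral>\<^sup>+s\<in>{0<..<1}. ennreal (1 / s) * indicator {x. (1 / b) *\<^sub>R x \<in> K \<and> x \<notin> K} ((1 / s) *\<^sub>R y) \<partial>lborel)"
proof -
  define R where "R = {s. s > 0 \<and> (1 / s) *\<^sub>R y \<in> K}"
  define r where "r = Inf R"
  have "1 \<in> R" using y by (simp add: R_def)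
  obtain B where B: "B > 0" "\<And>x. x \<in> K \<Longrightarrow> norm x \<le> B"
    using K bounded_pos by blast
  \<comment> \<open>Boundedness of \<open>K\<close> makes the gauge positive.\<close>
  have lower: "norm y / B \<le> s" if "s \<in> R" for s
    using that B(2)[of "(1 / s) *\<^sub>R y"] B(1) by (auto simp: R_def field_simps)
  then have bdd: "bdd_below R" by (intro bdd_belowI)
  have "norm y / B \<le> r" unfolding r_def using \<open>1 \<in> R\<close> lower by (intro cInf_greatest) auto
  moreover have "norm y / B > 0" using y B(1) by simp
  ultimately have r: "0 < r" "r \<le> 1"
    using \<open>1 \<in> R\<close> bdd by (linarith, simp add: r_def cInf_lower)
  have above: "t \<in> R" if "r < t" for t
  proof -
    from that have "\<exists>s\<in>R. s < t"
      unfolding r_def using \<open>1 \<in> R\<close> bdd by (subst (asm) cInf_less_iff) auto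
    then obtain s where s: "s \<in> R" "s < t" by blast
    then have "(1 / s) *\<^sub>R y \<in> K" "0 < s / t" "s / t < 1"
      by (auto simp: R_def)
    then have "(s / t) *\<^sub>R ((1 / s) *\<^sub>R y) \<in> K"
      by (rule star)
    with s show ?thesis by (auto simp: R_def)
  qed
  have below: "t \<notin> R" if "t < r" for t
    using that bdd cInf_lower[of t R] unfolding r_def by auto
  have shell: "(1 / b) *\<^sub>R ((1 / s) *\<^sub>R y) \<in> K \<and> (1 / s) *\<^sub>R y \<notin> K" if "r / b < s" "s < r" for s
  proof -
    have "r < b * s" using that b by (simp add: field_simps)
    moreover have "s > 0" using that b r by (meson divide_pos_pos less_trans zero_less_one)
    ultimately show ?thesis using above[of "b * s"] below[of s] that b by (auto simp: R_def)
  qed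
  have "(\<integral>\<^sup>+s. ennreal (1 / s) * indicator {r / b..r} s \<partial>lborel) = ennreal (ln r - ln (r / b))"
  proof (intro nn_integral_FTC_Icc)
    fix s assume "s \<in> {r / b..r}"
    then have "r / b \<le> s" by simp
    moreover have "r / b > 0" using r b by auto
    ultimately have "s > 0" by linarith
    then show "(ln has_real_derivative 1 / s) (at s)" by (auto intro!: derivative_eq_intros)
    show "0 \<le> 1 / s" using \<open>s > 0\<close> by simp
  qed (use r b in \<open>auto simp: field_simps\<close>)
  also have "ln r - ln (r / b) = ln b" using r b by (simp add: ln_div)
  finally have "ennreal (ln b) = (\<integral>\<^sup>+s. ennreal (1 / s) * indicator {r / b..r} s \<partial>lborel)" ..
  also have "\<dots> \<le> (\<integral>\<^sup>+s\<in>{0<..<1}. ennreal (1 / s) * indicator {x. (1 / b) *\<^sub>R x \<in> K \<and> x \<notin> K} ((1 / s) *\<^sub>R y) \<partial>lborel)"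
  proof (rule nn_integral_mono_AE)
    show "AE s in lborel. ennreal (1 / s) * indicator {r / b..r} s \<le>
      ennreal (1 / s) * indicator {x. (1 / b) *\<^sub>R x \<in> K \<and> x \<notin> K} ((1 / s) *\<^sub>R y) * indicator {0<..<1} s"
      using AE_lborel_singleton[of r] AE_lborel_singleton[of "r / b"]
    proof eventually_elim
      case (elim s)
      have "r / b > 0" using r b by auto
      then show ?case using elim shell[of s] r by (auto simp: indicator_def)
    qed
  qed
  finally show ?thesis .
qed

text \<open>
  As \<open>b\<close> tends to \<open>1\<close>, the relative volume \<open>b ^ m - 1\<close> of a thin shell is compared with its
  logarithmic thickness \<open>ln b\<close>.
\<close>

lemma power_minus_one_le:
  fixes b :: real
  assumes "b > 1"
  shows "b ^ m - 1 \<le> m * b ^ m * ln b"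
proof -
  have "ln (1 / b ^ m) \<le> 1 / b ^ m - 1" using assms by (intro ln_le_minus_one) auto
  then have "1 - 1 / b ^ m \<le> m * ln b" using assms by (simp add: ln_div ln_realpow)
  then have "b ^ m * (1 - 1 / b ^ m) \<le> b ^ m * (m * ln b)" using assms by (intro mult_left_mono) auto
  then show ?thesis using assms by (simp add: algebra_simps)
qed

lemma emeasure_shell:
  fixes K :: "'e::euclidean_space set"
  assumes [measurable]: "K \<in> sets borel" and K: "bounded K"
    and star: "\<And>x s. x \<in> K \<Longrightarrow> 0 < s \<Longrightarrow> s < 1 \<Longrightarrow> s *\<^sub>R x \<in> K"
    and b: "b > 1"
  shows "emeasure lborel {x. (1 / b) *\<^sub>R x \<in> K \<and> x \<notin> K} = ennreal (b ^ DIM('e) - 1) * emeasure lborel K"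
proof -
  have fin: "emeasure lborel K < \<infinity>" using K by (rule emeasure_bounded_finite)
  have [measurable]: "{x. (1 / b) *\<^sub>R x \<in> K} \<in> sets borel" by measurable
  have "K \<subseteq> {x. (1 / b) *\<^sub>R x \<in> K}" using star b by auto
  then have "emeasure lborel ({x. (1 / b) *\<^sub>R x \<in> K} - K) = emeasure lborel {x. (1 / b) *\<^sub>R x \<in> K} - emeasure lborel K"
    using fin by (intro emeasure_Diff) auto
  moreover have "emeasure lborel {x. (1 / b) *\<^sub>R x \<in> K} = ennreal (b ^ DIM('e)) * emeasure lborel K"
  proof -
    have "emeasure lborel {x. (1 / b) *\<^sub>R x \<in> K} = (\<integral>\<^sup>+x. indicator {x. (1 / b) *\<^sub>R x \<in> K} x \<partial>lborel)"
      by (rule nn_integral_indicator[symmetric]) simp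
    also have "\<dots> = (\<integral>\<^sup>+x. indicator K ((1 / b) *\<^sub>R x) \<partial>lborel)"
      by (intro nn_integral_cong) (simp add: indicator_def)
    also have "\<dots> = ennreal (b ^ DIM('e)) * (\<integral>\<^sup>+x. indicator K x \<partial>lborel)"
      using b by (subst nn_integral_lborel_affine[where c = b and t = 0]) simp_all
    finally show ?thesis by simp
  qed
  moreover have "{x. (1 / b) *\<^sub>R x \<in> K} - K = {x. (1 / b) *\<^sub>R x \<in> K \<and> x \<notin> K}" by auto
  moreover obtain v where "emeasure lborel K = ennreal v" "v \<ge> 0"
    using fin by (cases "emeasure lborel K") auto
  ultimately show ?thesis
    using b by (simp add: ennreal_mult''[symmetric] ennreal_minus algebra_simps)
qed

text \<open>
  A form of integration in polar coordinates that avoids the surface measure. Instead of over the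
  boundary of \<open>K\<close>, the radial integrals are averaged over the thin shell \<open>S = b K - K\<close> with \<open>b > 1\<close>,
  which is why the radial bound is required along all rays, also beyond \<open>K\<close>. By Tonelli and the
  homothety \<open>y = s x\<close> the average is an integral of \<open>f\<close> against the weight
  \<open>\<integral> 1\<^sub>S (y / s) ds / s\<close>, which is at least \<open>ln b\<close> on \<open>K\<close>. Thus
  \<open>ln b \<integral>\<^sub>K f \<le> c (b ^ D - 1) \<mu>(K)\<close>, and \<open>b \<rightarrow> 1\<close> gives the claim.
\<close>

lemma star_shaped_integral_le:
  fixes K :: "'e::euclidean_space set" and f :: "'e \<Rightarrow> ennreal" and c :: real
  assumes [measurable]: "K \<in> sets borel" "f \<in> borel_measurable borel" and K: "bounded K"
    and star: "\<And>x s. x \<in> K \<Longrightarrow> 0 < s \<Longrightarrow> s < 1 \<Longrightarrow> s *\<^sub>R x \<in> K"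
    and radial: "\<And>x. (\<integral>\<^sup>+s\<in>{0<..<1}. ennreal (s ^ (DIM('e) - 1)) * f (s *\<^sub>R x) \<partial>lborel) \<le> ennreal c"
    and c: "c \<ge> 0"
  shows "(\<integral>\<^sup>+x\<in>K. f x \<partial>lborel) \<le> ennreal (DIM('e) * c) * emeasure lborel K"
proof -
  let ?D = "DIM('e)"
  have fin: "emeasure lborel K < \<infinity>" using K by (rule emeasure_bounded_finite)
  then obtain v where v: "emeasure lborel K = ennreal v" "v \<ge> 0"
    by (cases "emeasure lborel K") auto
  have main: "(\<integral>\<^sup>+x\<in>K. f x \<partial>lborel) \<le> ennreal (?D * c * v * b ^ ?D)" if b: "b > 1" for b
  proof -
    define S where "S = {x. (1 / b) *\<^sub>R x \<in> K \<and> x \<notin> K}"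
    have [measurable]: "S \<in> sets borel" unfolding S_def by measurable
    let ?p = "\<lambda>s. ennreal (s ^ (?D - 1)) * indicator {0<..<1} s"
    \<comment> \<open>The substitution \<open>y = s x\<close> turns \<open>s ^ (D - 1)\<close> into \<open>s ^ (D - 1) / s ^ D = 1 / s\<close>.\<close>
    have homothety: "?p s * (\<integral>\<^sup>+x. indicator S x * f (s *\<^sub>R x) \<partial>lborel)
        = (\<integral>\<^sup>+y. ennreal (1 / s) * indicator {0<..<1} s * indicator S ((1 / s) *\<^sub>R y) * f y \<partial>lborel)" for s
    proof (cases "s \<in> {0<..<1}")
      case True
      let ?I = "\<integral>\<^sup>+x. indicator S x * f (s *\<^sub>R x) \<partial>lborel"
      have "(\<integral>\<^sup>+y. ennreal (1 / s) * indicator {0<..<1} s * indicator S ((1 / s) *\<^sub>R y) * f y \<partial>lborel)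
         = ennreal (1 / s) * (\<integral>\<^sup>+y. indicator S ((1 / s) *\<^sub>R y) * f y \<partial>lborel)"
        using True by (subst nn_integral_cmult[symmetric]) (auto simp: mult.assoc)
      also have "(\<integral>\<^sup>+y. indicator S ((1 / s) *\<^sub>R y) * f y \<partial>lborel) = ennreal (s ^ ?D) * ?I"
        using True by (subst nn_integral_lborel_affine[where c = s and t = 0]) auto
      also have "ennreal (1 / s) * (ennreal (s ^ ?D) * ?I) = ennreal (s ^ (?D - 1)) * ?I"
        using True by (simp add: mult.assoc[symmetric] ennreal_mult''[symmetric] power_diff)
      finally show ?thesis using True by simp
    qed auto
    have "ennreal (ln b) * (\<integral>\<^sup>+y\<in>K. f y \<partial>lborel) = (\<integral>\<^sup>+y. ennreal (ln b) * (f y * indicator K y) \<partial>lborel)"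
      by (simp add: nn_integral_cmult)
    also have "\<dots> \<le> (\<integral>\<^sup>+y. (\<integral>\<^sup>+s. ennreal (1 / s) * indicator {0<..<1} s * indicator S ((1 / s) *\<^sub>R y) * f y \<partial>lborel) \<partial>lborel)"
    proof (rule nn_integral_mono_AE)
      show "AE y in lborel. ennreal (ln b) * (f y * indicator K y) \<le> (\<integral>\<^sup>+s. ennreal (1 / s) * indicator {0<..<1} s * indicator S ((1 / s) *\<^sub>R y) * f y \<partial>lborel)"
        using AE_lborel_singleton[of 0]
      proof eventually_elim
        case (elim y)
        show ?case
        proof (cases "y \<in> K")
          case True
          have "ennreal (ln b) * f y \<le> (\<integral>\<^sup>+s\<in>{0<..<1}. ennreal (1 / s) * indicator S ((1 / s) *\<^sub>R y) \<partial>lborel) * f y"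
            unfolding S_def using True elim b K star by (intro mult_right_mono log_shell_integral_ge) auto
          also have "\<dots> = (\<integral>\<^sup>+s. ennreal (1 / s) * indicator {0<..<1} s * indicator S ((1 / s) *\<^sub>R y) * f y \<partial>lborel)"
            by (subst nn_integral_multc[symmetric]) (auto simp: mult_ac)
          finally show ?thesis using True by simp
        qed auto
      qed
    qed
    also have "\<dots> = (\<integral>\<^sup>+s. (\<integral>\<^sup>+y. ennreal (1 / s) * indicator {0<..<1} s * indicator S ((1 / s) *\<^sub>R y) * f y \<partial>lborel) \<partial>lborel)"
      by (rule lborel_pair.Fubini') measurable
    also have "\<dots> = (\<integral>\<^sup>+s. ?p s * (\<integral>\<^sup>+x. indicator S x * f (s *\<^sub>R x) \<partial>lborel) \<partial>lborel)"
      by (simp only: homothety)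
    also have "\<dots> = (\<integral>\<^sup>+s. (\<integral>\<^sup>+x. ?p s * (indicator S x * f (s *\<^sub>R x)) \<partial>lborel) \<partial>lborel)"
      by (subst nn_integral_cmult) auto
    also have "\<dots> = (\<integral>\<^sup>+x. (\<integral>\<^sup>+s. ?p s * (indicator S x * f (s *\<^sub>R x)) \<partial>lborel) \<partial>lborel)"
      by (rule lborel_pair.Fubini') measurable
    also have "\<dots> = (\<integral>\<^sup>+x. indicator S x * (\<integral>\<^sup>+s. ennreal (s ^ (?D - 1)) * f (s *\<^sub>R x) * indicator {0<..<1} s \<partial>lborel) \<partial>lborel)"
      by (subst nn_integral_cmult[symmetric]) (auto simp: mult_ac)
    also have "\<dots> \<le> (\<integral>\<^sup>+x. indicator S x * ennreal c \<partial>lborel)"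
      using radial by (intro nn_integral_mono mult_left_mono) auto
    also have "\<dots> = ennreal c * emeasure lborel S"
      by (simp add: nn_integral_cmult_indicator mult.commute)
    also have "emeasure lborel S = ennreal (b ^ ?D - 1) * ennreal v"
      unfolding S_def v(1)[symmetric] using K star b by (intro emeasure_shell) auto
    also have "ennreal c * (ennreal (b ^ ?D - 1) * ennreal v) = ennreal (c * v * (b ^ ?D - 1))"
      using c v b by (simp add: ennreal_mult''[symmetric] mult_ac)
    also have "\<dots> \<le> ennreal (c * v * (?D * b ^ ?D * ln b))"
      using c v power_minus_one_le[OF b] by (intro ennreal_leI mult_left_mono) auto
    also have "\<dots> = ennreal (ln b) * ennreal (?D * c * v * b ^ ?D)"
      using b c v by (simp add: ennreal_mult''[symmetric] mult_ac)
    finally show ?thesis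
      using b by (subst (asm) ennreal_mult_le_mult_iff) auto
  qed
  have "(\<lambda>n. ennreal (?D * c * v * (1 + 1 / real (Suc n)) ^ ?D)) \<longlonglongrightarrow> ennreal (?D * c * v * (1 + 0) ^ ?D)"
    by (intro tendsto_ennrealI tendsto_intros lim_const_over_n[THEN LIMSEQ_Suc])
  then have "(\<integral>\<^sup>+x\<in>K. f x \<partial>lborel) \<le> ennreal (?D * c * v * (1 + 0) ^ ?D)"
    using main by (intro LIMSEQ_le_const) auto
  then show ?thesis using v c by (simp add: ennreal_mult''[symmetric])
qed

section \<open>Products of polynomials on convex bodies\<close>

text \<open>
  The scalars are complex also for polynomials on real spaces, so that restrictions to lines always
  split into linear factors.
\<close>

definition line_polynomial :: "nat \<Rightarrow> ('a::real_vector \<Rightarrow> complex) \<Rightarrow> bool"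
  where "line_polynomial k F \<longleftrightarrow>
    (\<forall>x v. \<exists>q. degree q \<le> k \<and> (\<forall>s. F (x + s *\<^sub>R v) = poly q (of_real s)))"

text \<open>
  Translating \<open>x0\<close> to the origin turns the convex set \<open>B\<close> into a star-shaped one. The radial bound is
  the one-variable estimate for the restriction of \<open>F\<close> to the lines through \<open>x0\<close>.
\<close>

lemma integral_neg_ln_line_polynomial_le:
  fixes F :: "'e::euclidean_space \<Rightarrow> complex"
  assumes cont: "continuous_on UNIV F" and line: "line_polynomial k F"
    and B: "compact B" "convex B" and x0: "x0 \<in> B" "F x0 \<noteq> 0"
  shows "(\<integral>\<^sup>+x\<in>B. neg_ln (cmod (F x) / cmod (F x0)) \<partial>lborel)
    \<le> ennreal (k * (1 + ln (2 * real DIM('e)))) * emeasure lborel B"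
proof -
  have [measurable]: "F \<in> borel_measurable borel"
    using cont by (rule borel_measurable_continuous_onI)
  have [measurable]: "B \<in> sets borel"
    using B(1) by (simp add: compact_imp_closed)
  define K where "K = {y. x0 + y \<in> B}"
  define f where "f y = neg_ln (cmod (F (x0 + y)) / cmod (F x0))" for y
  have "(\<integral>\<^sup>+y\<in>K. f y \<partial>lborel) \<le> ennreal (DIM('e) * (k * ((1 + ln (2 * real DIM('e))) / DIM('e)))) * emeasure lborel K"
  proof (rule star_shaped_integral_le)
    show "K \<in> sets borel" unfolding K_def by measurable
    show "f \<in> borel_measurable borel" unfolding f_def[abs_def] by measurable
    have "K = (+) (- x0) ` B" by (force simp: K_def)
    then show "bounded K" using B(1) by (simp add: compact_imp_bounded bounded_translation_minus)
    show "s *\<^sub>R y \<in> K" if "y \<in> K" "0 < s" "s < 1" for y s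
    proof -
      have "(1 - s) *\<^sub>R x0 + s *\<^sub>R (x0 + y) \<in> B"
        using that B(2) x0(1) by (intro convexD) (auto simp: K_def)
      then show ?thesis by (simp add: K_def algebra_simps)
    qed
    show "(\<integral>\<^sup>+s\<in>{0<..<1}. ennreal (s ^ (DIM('e) - 1)) * f (s *\<^sub>R y) \<partial>lborel) \<le> ennreal (k * ((1 + ln (2 * real DIM('e))) / DIM('e)))" for y
    proof -
      obtain q where q: "degree q \<le> k" "\<And>s. F (x0 + s *\<^sub>R y) = poly q (of_real s)"
        using line unfolding line_polynomial_def by blast
      moreover from q(2)[of 0] have "F x0 = poly q 0" by simp
      ultimately show ?thesis
        using radial_neg_ln_poly[of "DIM('e)" q k] x0(2) unfolding f_def by (simp add: Suc_leI)
    qed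
    show "0 \<le> k * ((1 + ln (2 * real DIM('e))) / DIM('e))"
      by (intro mult_nonneg_nonneg divide_nonneg_nonneg add_nonneg_nonneg ln_ge_zero) (auto simp: Suc_leI mult_ge1_I)
  qed
  moreover have "(\<integral>\<^sup>+x\<in>B. neg_ln (cmod (F x) / cmod (F x0)) \<partial>lborel) = (\<integral>\<^sup>+y\<in>K. f y \<partial>lborel)"
    by (subst nn_integral_lborel_affine[where c = 1 and t = x0]) (auto simp: f_def K_def indicator_def)
  moreover have "emeasure lborel K = emeasure lborel B"
  proof -
    have "emeasure lborel B = (\<integral>\<^sup>+x. indicator B x \<partial>lborel)" by simp
    also have "\<dots> = (\<integral>\<^sup>+x. indicator B (x0 + x) \<partial>lborel)"
      by (subst nn_integral_lborel_affine[where c = 1 and t = x0]) auto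
    also have "\<dots> = (\<integral>\<^sup>+x. indicator K x \<partial>lborel)"
      by (intro nn_integral_cong) (simp add: K_def indicator_def)
    also have "\<dots> = emeasure lborel K"
      unfolding K_def by (rule nn_integral_indicator) measurable
    finally show ?thesis ..
  qed
  ultimately show ?thesis by simp
qed

text \<open>
  On \<open>B\<close> every summand \<open>neg_ln (|F i| / M i)\<close> has the integral bound of the preceding lemma, with the
  respective maximum point as centre. The sum of these functions is bounded below by the constant
  \<open>neg_ln u\<close>, where \<open>u\<close> is the supremum of the product divided by the product of the suprema.
  Integrating over \<open>B\<close> and dividing by its measure bounds \<open>- ln u\<close>.
\<close>

lemma prod_sup_le_euclidean:
  fixes F :: "nat \<Rightarrow> 'e::euclidean_space \<Rightarrow> complex"
  assumes I: "finite I"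
    and cont: "\<And>i. i \<in> I \<Longrightarrow> continuous_on UNIV (F i)"
    and line: "\<And>i. i \<in> I \<Longrightarrow> line_polynomial (k i) (F i)"
    and B: "compact B" "convex B" "interior B \<noteq> {}"
  shows "0 \<le> (SUP x\<in>B. cmod (\<Prod>i\<in>I. F i x))"
    and "(\<Prod>i\<in>I. SUP x\<in>B. cmod (F i x))
    \<le> (2 * exp 1 * DIM('e)) ^ (\<Sum>i\<in>I. k i) * (SUP x\<in>B. cmod (\<Prod>i\<in>I. F i x))"
proof -
  define M where "M i = (SUP x\<in>B. cmod (F i x))" for i
  define m where "m = (SUP x\<in>B. cmod (\<Prod>i\<in>I. F i x))"
  define C where "C = (\<Sum>i\<in>I. k i * (1 + ln (2 * real DIM('e))))"
  have "B \<noteq> {}" using B(3) by auto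
  have [measurable]: "B \<in> sets borel"
    using B(1) by (simp add: compact_imp_closed)
  have [measurable]: "F i \<in> borel_measurable borel" if "i \<in> I" for i
    using cont[OF that] by (rule borel_measurable_continuous_onI)
  have "emeasure lborel B < \<infinity>" using B(1) by (intro emeasure_bounded_finite compact_imp_bounded)
  \<comment> \<open>The measure of \<open>B\<close> has to be positive, so that it can be cancelled at the end.\<close>
  have "emeasure lborel B \<noteq> 0"
  proof
    assume "emeasure lborel B = 0"
    then have "negligible B"
      by (auto simp: negligible_iff_null_sets null_sets_def)
    then show False
      using B(3) open_not_negligible[of "interior B"] negligible_subset[OF _ interior_subset] by auto
  qed
  have attained: "\<exists>x\<in>B. cmod (F i x) = M i" if "i \<in> I" for i
  proof -
    have "continuous_on B (\<lambda>x. cmod (F i x))"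
      using cont[OF that] by (intro continuous_on_norm) (rule continuous_on_subset, auto)
    from continuous_attains_sup[OF B(1) \<open>B \<noteq> {}\<close> this]
    obtain x where x: "x \<in> B" "\<And>y. y \<in> B \<Longrightarrow> cmod (F i y) \<le> cmod (F i x)" by blast
    then have "M i = cmod (F i x)" unfolding M_def
      by (intro cSup_eq_maximum) auto
    with x show ?thesis by auto
  qed
  have bdd: "bdd_above ((\<lambda>x. cmod (\<Prod>i\<in>I. F i x)) ` B)"
  proof -
    have "continuous_on B (\<lambda>x. cmod (\<Prod>i\<in>I. F i x))"
      using cont by (intro continuous_on_norm continuous_on_prod) (rule continuous_on_subset, auto)
    then show ?thesis
      using B(1) by (intro bounded_imp_bdd_above compact_imp_bounded compact_continuous_image)
  qed
  have m: "cmod (\<Prod>i\<in>I. F i x) \<le> m" if "x \<in> B" for x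
    unfolding m_def using that bdd by (rule cSUP_upper)
  then have "m \<ge> 0" using \<open>B \<noteq> {}\<close> norm_ge_zero by (meson all_not_in_conv order_trans)
  have M: "M i \<ge> 0" if "i \<in> I" for i using attained[OF that] by (metis norm_ge_zero)
  have D: "1 \<le> real DIM('e)" by (simp add: Suc_leI)
  have L: "1 + ln (2 * real DIM('e)) \<ge> 0" using D by (intro add_nonneg_nonneg ln_ge_zero) linarith+
  have "(\<Prod>i\<in>I. M i) \<le> exp C * m"
  proof (cases "\<exists>i\<in>I. M i = 0")
    case True
    with I have "(\<Prod>i\<in>I. M i) = 0" by (rule prod_zero)
    with \<open>m \<ge> 0\<close> show ?thesis by simp
  next
    case False
    with M have pos: "M i > 0" if "i \<in> I" for i using that by (metis order_le_less)
    then have PM: "(\<Prod>i\<in>I. M i) > 0" by (intro prod_pos) auto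
    define u where "u = m / (\<Prod>i\<in>I. M i)"
    have "neg_ln u \<le> (\<Sum>i\<in>I. neg_ln (cmod (F i x) / M i))" if "x \<in> B" for x
    proof -
      have "(\<Prod>i\<in>I. cmod (F i x) / M i) \<le> u"
        using m[OF that] PM by (simp add: u_def prod_dividef prod_norm divide_right_mono)
      then have "neg_ln u \<le> neg_ln (\<Prod>i\<in>I. cmod (F i x) / M i)"
        by (rule neg_ln_antimono)
      also have "\<dots> \<le> (\<Sum>i\<in>I. neg_ln (cmod (F i x) / M i))"
        using M by (intro neg_ln_prod_le) auto
      finally show ?thesis .
    qed
    then have "(\<integral>\<^sup>+x\<in>B. neg_ln u \<partial>lborel) \<le> (\<integral>\<^sup>+x. (\<Sum>i\<in>I. neg_ln (cmod (F i x) / M i) * indicator B x) \<partial>lborel)"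
      by (intro nn_integral_mono) (auto simp: indicator_def)
    also have "\<dots> = (\<Sum>i\<in>I. \<integral>\<^sup>+x\<in>B. neg_ln (cmod (F i x) / M i) \<partial>lborel)"
      by (intro nn_integral_sum) measurable
    also have "\<dots> \<le> (\<Sum>i\<in>I. ennreal (k i * (1 + ln (2 * real DIM('e)))) * emeasure lborel B)"
    proof (rule sum_mono)
      fix i assume i: "i \<in> I"
      obtain x where x: "x \<in> B" "cmod (F i x) = M i" using attained[OF i] by blast
      with pos[OF i] have "F i x \<noteq> 0" by auto
      from integral_neg_ln_line_polynomial_le[OF cont[OF i] line[OF i] B(1,2) x(1) this]
      show "(\<integral>\<^sup>+x\<in>B. neg_ln (cmod (F i x) / M i) \<partial>lborel) \<le> ennreal (k i * (1 + ln (2 * real DIM('e)))) * emeasure lborel B"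
        unfolding x(2) .
    qed
    also have "\<dots> = (\<Sum>i\<in>I. ennreal (k i * (1 + ln (2 * real DIM('e))))) * emeasure lborel B"
      by (rule sum_distrib_right[symmetric])
    also have "(\<Sum>i\<in>I. ennreal (k i * (1 + ln (2 * real DIM('e))))) = ennreal C"
      unfolding C_def using L by (intro sum_ennreal) simp
    also have "(\<integral>\<^sup>+x\<in>B. neg_ln u \<partial>lborel) = neg_ln u * emeasure lborel B"
      by (rule nn_integral_cmult_indicator) simp
    finally have "emeasure lborel B * neg_ln u \<le> emeasure lborel B * ennreal C"
      by (simp only: mult.commute)
    then have le: "neg_ln u \<le> ennreal C"
      using \<open>emeasure lborel B < \<infinity>\<close> \<open>emeasure lborel B \<noteq> 0\<close> by (subst (asm) ennreal_mult_le_mult_iff) auto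
    \<comment> \<open>At \<open>u = 0\<close> the function \<open>neg_ln\<close> is infinite.\<close>
    have "u > 0"
      using le by (rule contrapos_pp) (auto simp: neg_ln_def top_unique)
    moreover have "C \<ge> 0" unfolding C_def using L by (intro sum_nonneg) auto
    ultimately have "- C \<le> ln u"
      using le by (auto simp: neg_ln_def ennreal_le_iff)
    then have "exp (- C) \<le> u" using \<open>u > 0\<close> by (metis exp_le_cancel_iff exp_ln)
    then show ?thesis using PM by (simp add: u_def exp_minus field_simps)
  qed
  also have "exp C = (2 * exp 1 * DIM('e)) ^ (\<Sum>i\<in>I. k i)"
  proof -
    have "exp (1 + ln (2 * real DIM('e))) = 2 * exp 1 * DIM('e)"
      using D by (simp add: exp_add)
    moreover have "C = real (\<Sum>i\<in>I. k i) * (1 + ln (2 * real DIM('e)))"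
      by (simp add: C_def sum_distrib_right)
    ultimately show ?thesis by (simp add: exp_of_nat_mult del: of_nat_sum)
  qed
  finally show "(\<Prod>i\<in>I. SUP x\<in>B. cmod (F i x))
    \<le> (2 * exp 1 * DIM('e)) ^ (\<Sum>i\<in>I. k i) * (SUP x\<in>B. cmod (\<Prod>i\<in>I. F i x))"
    unfolding M_def m_def .
  show "0 \<le> (SUP x\<in>B. cmod (\<Prod>i\<in>I. F i x))"
    using \<open>m \<ge> 0\<close> unfolding m_def .
qed

section \<open>Linear coordinates on finite-dimensional spaces\<close>

text \<open>
  Lebesgue measure lives on types of class \<open>euclidean_space\<close>, whereas the dimension of \<open>'a\<close> is only
  known through the function \<open>dim\<close>. An index type of that cardinality, depending on \<open>'a\<close>, turns
  \<open>real ^ 'a basis_index\<close> into a Euclidean space of the same dimension as \<open>'a\<close>. The maximum with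
  \<open>1\<close> makes the index set nonempty, as types have to be.
\<close>

typedef (overloaded) ('a::real_vector) basis_index = "{..<max 1 (dim (UNIV :: 'a set))}"
  by (auto simp: lessThan_empty_iff intro: exI[of _ 0])
instance basis_index :: (real_vector) finite
proof
  show "finite (UNIV :: 'a basis_index set)"
    using type_definition.Abs_image[OF type_definition_basis_index] by (metis finite_imageI finite_lessThan)
qed
lemma card_basis_index: "CARD('a::real_vector basis_index) = max 1 (dim (UNIV :: 'a set))"
  using type_definition.card[OF type_definition_basis_index] by simp

lemma ex_coordinates:
  assumes "dim (UNIV :: 'a::real_vector set) \<ge> 1"
  shows "\<exists>\<phi> :: real ^ 'a basis_index \<Rightarrow> 'a. linear \<phi> \<and> bij \<phi>"
proof -
  obtain R :: "'a set" where R: "independent R" "UNIV \<subseteq> span R" "card R = dim (UNIV :: 'a set)"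
    using basis_exists[of "UNIV :: 'a set"] by metis
  then have "finite R" using assms by (metis card.infinite not_one_le_zero)
  have "card R = CARD('a basis_index)" using assms R(3) by (simp add: card_basis_index)
  then obtain h :: "'a basis_index \<Rightarrow> 'a" where h: "bij_betw h UNIV R"
    using \<open>finite R\<close> by (metis finite_same_card_bij finite)
  define \<phi> :: "real ^ 'a basis_index \<Rightarrow> 'a" where "\<phi> v = (\<Sum>i\<in>UNIV. v $ i *\<^sub>R h i)" for v
  have lin: "linear \<phi>"
    by (rule linearI) (simp_all add: \<phi>_def scaleR_left_distrib sum.distrib scaleR_sum_right)
  have reindex: "(\<Sum>i\<in>UNIV. u (h i) *\<^sub>R h i) = (\<Sum>b\<in>R. u b *\<^sub>R b)" for u
    using h by (rule sum.reindex_bij_betw)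
  have "inj \<phi>"
    unfolding linear_injective_0[OF lin]
  proof (intro allI impI)
    fix v assume "\<phi> v = 0"
    define u where "u b = v $ (inv h b)" for b
    have inv: "inv h (h i) = i" for i
      using h by (simp add: bij_betw_def)
    have "(\<Sum>b\<in>R. u b *\<^sub>R b) = 0"
      using \<open>\<phi> v = 0\<close> reindex[of u] by (simp add: \<phi>_def u_def inv)
    then have "u (h i) = 0" for i
      using h independentD[OF R(1) \<open>finite R\<close> order_refl, of u "h i"] by (auto simp: bij_betw_def)
    then show "v = 0" by (simp add: u_def inv vec_eq_iff)
  qed
  moreover have "surj \<phi>"
    unfolding surj_def
  proof
    fix x
    obtain u where "x = (\<Sum>b\<in>R. u b *\<^sub>R b)"
      using R(2) span_finite[OF \<open>finite R\<close>] by blast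
    then have "x = \<phi> (\<chi> i. u (h i))" by (simp add: \<phi>_def reindex)
    then show "\<exists>v. x = \<phi> v" ..
  qed
  ultimately show ?thesis using lin by (auto simp: bij_def)
qed

text \<open>
  In linear coordinates the unit ball becomes a compact convex set with nonempty interior, and
  restrictions to lines keep their degree bounds.
\<close>

lemma prod_poly_norm_le:
  fixes F :: "nat \<Rightarrow> 'a::real_normed_vector \<Rightarrow> complex"
  assumes dim: "dim (UNIV :: 'a set) \<ge> 1" and I: "finite I"
    and cont: "\<And>i. i \<in> I \<Longrightarrow> continuous_on UNIV (F i)"
    and line: "\<And>i. i \<in> I \<Longrightarrow> line_polynomial (k i) (F i)"
  shows "0 \<le> poly_norm (\<lambda>z. \<Prod>i\<in>I. F i z)"
    and "(\<Prod>i\<in>I. poly_norm (F i))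
    \<le> (2 * exp 1 * dim (UNIV :: 'a set)) ^ (\<Sum>i\<in>I. k i) * poly_norm (\<lambda>z. \<Prod>i\<in>I. F i z)"
proof -
  obtain \<phi> :: "real ^ 'a basis_index \<Rightarrow> 'a" where lin: "linear \<phi>" and "bij \<phi>"
    using ex_coordinates[OF dim] by blast
  have cont\<phi>: "continuous_on S \<phi>" for S
    using lin by (simp add: linear_conv_bounded_linear linear_continuous_on)
  define B where "B = \<phi> -` cball 0 1"
  have image: "\<phi> ` B = cball 0 1"
    unfolding B_def using \<open>bij \<phi>\<close> by (simp add: bij_is_surj surj_image_vimage_eq)
  have sup: "poly_norm G = (SUP x\<in>B. cmod (G (\<phi> x)))" for G
    unfolding poly_norm_def image[symmetric] by (simp add: image_image)
  have "convex B" unfolding B_def using lin by (intro convex_linear_vimage) auto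
  have "bounded B"
  proof -
    have "continuous_on (sphere 0 1) (\<lambda>x. norm (\<phi> x))" by (intro continuous_on_norm cont\<phi>)
    moreover have "sphere 0 1 \<noteq> ({} :: (real ^ 'a basis_index) set)" by simp
    ultimately obtain e where e: "e \<in> sphere 0 1" "\<And>x. x \<in> sphere 0 1 \<Longrightarrow> norm (\<phi> e) \<le> norm (\<phi> x)"
      using continuous_attains_inf[OF compact_sphere] by metis
    have "\<phi> e \<noteq> 0"
      using e(1) \<open>bij \<phi>\<close> linear_injective_0[OF lin] by (auto simp: bij_def)
    \<comment> \<open>By homogeneity, \<open>\<phi>\<close> expands all norms at least by its minimum over the unit sphere.\<close>
    have "norm x \<le> 1 / norm (\<phi> e)" if "x \<in> B" for x
    proof (cases "x = 0")
      case False
      then have "norm (\<phi> e) \<le> norm (\<phi> ((1 / norm x) *\<^sub>R x))" by (intro e) simp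
      also have "\<dots> = norm (\<phi> x) / norm x" using lin by (simp add: linear_scale)
      also have "\<dots> \<le> 1 / norm x" using that by (intro divide_right_mono) (auto simp: B_def)
      finally show ?thesis using False \<open>\<phi> e \<noteq> 0\<close> by (simp add: field_simps)
    qed simp
    then show ?thesis by (auto simp: bounded_iff)
  qed
  moreover have "closed B" unfolding B_def by (intro closed_vimage cont\<phi>) simp
  ultimately have "compact B" by (simp add: compact_eq_bounded_closed)
  have "\<phi> -` ball 0 1 \<subseteq> interior B"
    by (intro interior_maximal open_vimage cont\<phi>) (auto simp: B_def)
  moreover have "0 \<in> \<phi> -` ball 0 1" using lin by (simp add: linear_0)
  ultimately have "interior B \<noteq> {}" by blast
  have "continuous_on UNIV (\<lambda>x. F i (\<phi> x))" if "i \<in> I" for i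
    using cont[OF that] by (intro continuous_on_compose2[OF _ cont\<phi>]) auto
  moreover have "line_polynomial (k i) (\<lambda>x. F i (\<phi> x))" if "i \<in> I" for i
    using line[OF that] lin unfolding line_polynomial_def by (simp add: linear_add linear_scale)
  ultimately have "0 \<le> (SUP x\<in>B. cmod (\<Prod>i\<in>I. F i (\<phi> x))) \<and> (\<Prod>i\<in>I. SUP x\<in>B. cmod (F i (\<phi> x)))
    \<le> (2 * exp 1 * DIM(real ^ 'a basis_index)) ^ (\<Sum>i\<in>I. k i) * (SUP x\<in>B. cmod (\<Prod>i\<in>I. F i (\<phi> x)))"
    by (intro conjI prod_sup_le_euclidean I \<open>compact B\<close> \<open>convex B\<close> \<open>interior B \<noteq> {}\<close>)
  then show "0 \<le> poly_norm (\<lambda>z. \<Prod>i\<in>I. F i z)"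
    and "(\<Prod>i\<in>I. poly_norm (F i))
      \<le> (2 * exp 1 * dim (UNIV :: 'a set)) ^ (\<Sum>i\<in>I. k i) * poly_norm (\<lambda>z. \<Prod>i\<in>I. F i z)"
    using dim by (simp_all add: sup card_basis_index)
qed

section \<open>Restricting polynomials to lines\<close>

text \<open>
  Induction on the number \<open>m\<close> of arguments that vary with \<open>t\<close>: linearity in the argument with index
  \<open>m\<close> gives one polynomial plus \<open>t\<close> times another one, both from the induction hypothesis with
  that argument held constant. This is why the fixed arguments \<open>w\<close> are generalized.
\<close>

lemma continuous_multilinear_on_lines:
  fixes T :: "(nat \<Rightarrow> 'a::real_normed_vector) \<Rightarrow> 'k::real_normed_field"
  assumes T: "continuous_multilinear smul l T" and "m \<le> l"
  shows "\<exists>q. degree q \<le> m \<and>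
    (\<forall>t. T (\<lambda>i\<in>{..<l}. if i < m then u i + smul t (v i) else w i) = poly q t)"
  using \<open>m \<le> l\<close>
proof (induction m arbitrary: w)
  case 0
  show ?case by (intro exI[of _ "[:T (\<lambda>i\<in>{..<l}. w i):]"]) (simp add: restrict_def)
next
  case (Suc m)
  define X where "X w t = (\<lambda>i\<in>{..<l}. if i < m then u i + smul t (v i) else w i)" for w t
  obtain q1 where q1: "degree q1 \<le> m" "\<And>t. T (X (w(m := u m)) t) = poly q1 t"
    using Suc.IH[of "w(m := u m)"] Suc_leD[OF Suc.prems] unfolding X_def by blast
  obtain q2 where q2: "degree q2 \<le> m" "\<And>t. T (X (w(m := v m)) t) = poly q2 t"
    using Suc.IH[of "w(m := v m)"] Suc_leD[OF Suc.prems] unfolding X_def by blast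
  have upd: "X (w(m := a)) t = (X w t)(m := a)" for a t
    using Suc.prems by (auto simp: X_def fun_eq_iff)
  have "T (\<lambda>i\<in>{..<l}. if i < Suc m then u i + smul t (v i) else w i) = poly (q1 + pCons 0 q2) t" for t
  proof -
    interpret lin: Vector_Spaces.linear smul "(*)" "\<lambda>a. T ((X w t)(m := a))"
      using T Suc.prems unfolding continuous_multilinear_def by (auto simp: X_def)
    have "(\<lambda>i\<in>{..<l}. if i < Suc m then u i + smul t (v i) else w i) = (X w t)(m := u m + smul t (v m))"
      using Suc.prems by (auto simp: X_def fun_eq_iff less_Suc_eq)
    then show ?thesis
      using q1(2)[of t] q2(2)[of t] by (simp add: upd lin.add lin.scale)
  qed
  moreover have "degree (q1 + pCons 0 q2) \<le> Suc m"
    using q1(1) q2(1) degree_pCons_le[of 0 q2] by (intro degree_add_le) auto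
  ultimately show ?case by blast
qed

lemma homogeneous_polynomial_on_lines:
  assumes "homogeneous_polynomial smul l P"
  shows "\<exists>q. degree q \<le> l \<and> (\<forall>t. P (x + smul t v) = poly q t)"
proof -
  from assms obtain T where T: "continuous_multilinear smul l T" "\<And>z. P z = T (\<lambda>i\<in>{..<l}. z)"
    unfolding homogeneous_polynomial_def by auto
  have "(\<lambda>i\<in>{..<l}. if i < l then x + smul t v else 0) = (\<lambda>i\<in>{..<l}. x + smul t v)" for t
    by (auto simp: fun_eq_iff)
  then show ?thesis
    using continuous_multilinear_on_lines[OF T(1) order_refl, of "\<lambda>_. x" "\<lambda>_. v" "\<lambda>_. 0"] T(2) by simp
qed

lemma polynomial_of_degree_on_lines:
  assumes "polynomial_of_degree smul k P"
  shows "\<exists>q. degree q \<le> k \<and> (\<forall>t. P (x + smul t v) = poly q t)"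
proof -
  from assms obtain Q c where Q: "\<And>z. Q 0 z = c" "\<And>l. l \<in> {1..k} \<Longrightarrow> homogeneous_polynomial smul l (Q l)"
    "\<And>z. P z = (\<Sum>l=0..k. Q l z)"
    unfolding polynomial_of_degree_def by metis
  have "\<exists>q. degree q \<le> l \<and> (\<forall>t. Q l (x + smul t v) = poly q t)" if "l \<in> {0..k}" for l
  proof (cases "l = 0")
    case True
    then show ?thesis using Q(1) by (intro exI[of _ "[:c:]"]) auto
  qed (use that Q(2)[of l] in \<open>auto intro!: homogeneous_polynomial_on_lines\<close>)
  then obtain q where q: "\<And>l. l \<in> {0..k} \<Longrightarrow> degree (q l) \<le> l" "\<And>l t. l \<in> {0..k} \<Longrightarrow> Q l (x + smul t v) = poly (q l) t"
    by metis
  have "degree (\<Sum>l=0..k. q l) \<le> k"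
    using q(1) by (intro degree_sum_le) (auto intro: order_trans)
  then show ?thesis
    using q(2) Q(3) by (intro exI[of _ "\<Sum>l=0..k. q l"]) (auto simp: poly_sum)
qed

lemma polynomial_of_degree_continuous:
  assumes "polynomial_of_degree smul k P"
  shows "continuous_on UNIV P"
proof -
  from assms obtain Q c where Q: "\<And>z. Q 0 z = c" "\<And>l. l \<in> {1..k} \<Longrightarrow> homogeneous_polynomial smul l (Q l)"
    "\<And>z. P z = (\<Sum>l=0..k. Q l z)"
    unfolding polynomial_of_degree_def by metis
  have "continuous_on UNIV (Q l)" if "l \<in> {0..k}" for l
  proof (cases "l = 0")
    case True
    then show ?thesis using Q(1) by simp
  next
    case False
    with that Q(2)[of l] obtain T where T: "continuous_multilinear smul l T" "\<And>z. Q l z = T (\<lambda>i\<in>{..<l}. z)"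
      unfolding homogeneous_polynomial_def by auto
    have "continuous_map euclidean (product_topology (\<lambda>_. euclidean) {..<l}) (\<lambda>z. \<lambda>i\<in>{..<l}. z)"
      by (subst continuous_map_componentwise) (auto simp: continuous_map_id[unfolded id_def])
    then have "continuous_map euclidean euclidean (T \<circ> (\<lambda>z. \<lambda>i\<in>{..<l}. z))"
      using T(1) unfolding continuous_multilinear_def by (intro continuous_map_compose) auto
    then show ?thesis
      using T(2) by (simp add: o_def fun_eq_iff[symmetric])
  qed
  then show ?thesis
    unfolding Q(3)[abs_def] by (intro continuous_on_sum) auto
qed

lemma line_polynomial_real:
  assumes "polynomial_of_degree (*\<^sub>R) k P"
  shows "line_polynomial k (\<lambda>z. of_real (P z))"
  unfolding line_polynomial_def
proof (intro allI)
  fix x v :: 'a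
  obtain q where q: "degree q \<le> k" "\<And>t. P (x + t *\<^sub>R v) = poly q t"
    using polynomial_of_degree_on_lines[OF assms] by blast
  have "poly (map_poly of_real q) (of_real t) = complex_of_real (poly q t)" for t
    by (induction q) (auto simp: map_poly_pCons)
  with q show "\<exists>q. degree q \<le> k \<and> (\<forall>s. complex_of_real (P (x + s *\<^sub>R v)) = poly q (of_real s))"
    by (intro exI[of _ "map_poly of_real q"]) (auto intro!: order_trans[OF map_poly_degree_leq])
qed

lemma line_polynomial_complex:
  assumes "complex_banach_space smul" "polynomial_of_degree smul k P"
  shows "line_polynomial k P"
  unfolding line_polynomial_def
proof (intro allI)
  fix x v
  interpret complex_banach_space smul by fact
  show "\<exists>q. degree q \<le> k \<and> (\<forall>s. P (x + s *\<^sub>R v) = poly q (of_real s))"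
    using polynomial_of_degree_on_lines[OF assms(2), of x v] by (metis scale_of_real)
qed

section \<open>Real dimension of complex spaces\<close>

text \<open>
  If \<open>B\<close> is a complex basis, the vectors \<open>b\<close> and \<open>\<i> b\<close> with \<open>b\<close> in \<open>B\<close> span the space over the reals.
\<close>

lemma complex_banach_space_real_dim:
  fixes smul :: "complex \<Rightarrow> 'b::banach \<Rightarrow> 'b"
  assumes "complex_banach_space smul" and d: "vector_space.dim smul (UNIV :: 'b set) = d" "d \<ge> 1"
  shows "1 \<le> dim (UNIV :: 'b set)" "dim (UNIV :: 'b set) \<le> 2 * d"
proof -
  interpret C: complex_banach_space smul by fact
  obtain B where B: "C.independent B" "UNIV \<subseteq> C.span B" "card B = d"
    using C.basis_exists[of UNIV] d(1) by metis
  have "finite B" using B(3) d(2) by (metis card.infinite not_one_le_zero)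
  let ?W = "B \<union> smul \<i> ` B"
  have cardW: "card ?W \<le> 2 * d"
    using card_Un_le[of B "smul \<i> ` B"] card_image_le[OF \<open>finite B\<close>, of "smul \<i>"] B(3) by simp
  have span: "UNIV \<subseteq> span ?W"
  proof
    fix x
    obtain u where "x = (\<Sum>b\<in>B. smul (u b) b)"
      using B(2) C.span_finite[OF \<open>finite B\<close>] by blast
    moreover have "smul c b \<in> span ?W" if "b \<in> B" for c b
    proof -
      have "smul c b = smul (of_real (Re c)) b + smul (of_real (Im c)) (smul \<i> b)"
        by (metis C.scale_left_distrib C.scale_scale complex_eq mult.commute)
      also have "\<dots> = Re c *\<^sub>R b + Im c *\<^sub>R smul \<i> b"
        by (simp only: C.scale_of_real)
      also have "\<dots> \<in> span ?W"
        using that by (intro span_add span_scale span_base) auto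
      finally show ?thesis .
    qed
    ultimately show "x \<in> span ?W" by (auto intro!: span_sum)
  qed
  obtain R :: "'b set" where R: "independent R" "UNIV \<subseteq> span R" "card R = dim (UNIV :: 'b set)"
    using basis_exists[of "UNIV :: 'b set"] by metis
  have "finite R \<and> card R \<le> card ?W"
    using R(1) span \<open>finite B\<close> by (intro independent_span_bound) auto
  with R(3) cardW show "dim (UNIV :: 'b set) \<le> 2 * d" by simp
  have "R \<noteq> {}"
  proof
    assume "R = {}"
    with R(2) have "x = 0" for x :: 'b by auto
    with B(1) have "B = {}" using C.dependent_zero by (metis all_not_in_conv)
    with B(3) d(2) show False by simp
  qed
  with \<open>finite R \<and> _\<close> R(3) show "1 \<le> dim (UNIV :: 'b set)"
    by (metis card_gt_0_iff One_nat_def Suc_leI)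
qed

section \<open>The norm inequality\<close>

text \<open>
  For \<open>K\<close> the total degree and \<open>r\<close> at most the number of polynomials, \<open>r \<le> K\<close> because all degrees
  are at least \<open>1\<close>; then \<open>2 ^ K\<close> absorbs the denominator.
\<close>

lemma power_le_double_power_div_powr:
  fixes x :: real
  assumes "0 \<le> x" "r \<le> real K"
  shows "x ^ K \<le> (2 * x) ^ K / 2 powr r"
proof -
  have "2 powr r \<le> 2 powr real K" using assms(2) by simp
  then have "x ^ K * 2 powr r \<le> x ^ K * 2 ^ K"
    using assms(1) by (intro mult_left_mono) (auto simp: powr_realpow)
  then show ?thesis by (simp add: field_simps power_mult_distrib)
qed

theorem theorem1p1:
  fixes P :: "nat \<Rightarrow> 'a::banach \<Rightarrow> real"
    and scaleC :: "complex \<Rightarrow> 'b::banach \<Rightarrow> 'b"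
    and Q :: "nat \<Rightarrow> 'b \<Rightarrow> complex"
    and d n :: nat and k :: "nat \<Rightarrow> nat"
  assumes "d \<ge> 1" and "\<forall>i\<in>{1..n}. k i \<ge> 1"
  shows
    "(dim (UNIV :: 'a set) = d \<and>
      (\<forall>i\<in>{1..n}. polynomial_of_degree (*\<^sub>R) (k i) (P i))
      \<longrightarrow> (\<Prod>i=1..n. poly_norm (P i))
          \<le> (1 * 4 * exp 1 * real d) ^ (\<Sum>i=1..n. k i) / 2 powr (real n / 1)
             * poly_norm (\<lambda>z. \<Prod>i=1..n. P i z)) \<and>
     (complex_banach_space scaleC \<and> vector_space.dim scaleC (UNIV :: 'b set) = d \<and>
      (\<forall>i\<in>{1..n}. polynomial_of_degree scaleC (k i) (Q i))
      \<longrightarrow> (\<Prod>i=1..n. poly_norm (Q i))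
          \<le> (2 * 4 * exp 1 * real d) ^ (\<Sum>i=1..n. k i) / 2 powr (real n / 2)
             * poly_norm (\<lambda>z. \<Prod>i=1..n. Q i z))"
proof -
  let ?K = "\<Sum>i=1..n. k i"
  have "(\<Sum>i=1..n. 1) \<le> ?K" using assms(2) by (intro sum_mono) auto
  then have "n \<le> ?K" by simp
  then have n_le: "real n \<le> real ?K" by (simp only: of_nat_le_iff)
  have real_case: "(\<Prod>i=1..n. poly_norm (P i))
      \<le> (1 * 4 * exp 1 * real d) ^ ?K / 2 powr (real n / 1) * poly_norm (\<lambda>z. \<Prod>i=1..n. P i z)"
    if dim: "dim (UNIV :: 'a set) = d" and P: "\<forall>i\<in>{1..n}. polynomial_of_degree (*\<^sub>R) (k i) (P i)"
  proof -
    have norm_eq: "poly_norm (\<lambda>z. complex_of_real (G z)) = poly_norm G" for G :: "'a \<Rightarrow> real"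
      by (simp add: poly_norm_def)
    have "1 \<le> dim (UNIV :: 'a set)" using dim assms(1) by simp
    moreover have "continuous_on UNIV (\<lambda>z. complex_of_real (P i z))" if "i \<in> {1..n}" for i
      using P that by (intro continuous_on_of_real polynomial_of_degree_continuous) auto
    moreover have "line_polynomial (k i) (\<lambda>z. of_real (P i z))" if "i \<in> {1..n}" for i
      using P that by (intro line_polynomial_real) auto
    ultimately have *: "0 \<le> poly_norm (\<lambda>z. \<Prod>i=1..n. complex_of_real (P i z)) \<and>
        (\<Prod>i=1..n. poly_norm (\<lambda>z. complex_of_real (P i z)))
        \<le> (2 * exp 1 * dim (UNIV :: 'a set)) ^ ?K * poly_norm (\<lambda>z. \<Prod>i=1..n. complex_of_real (P i z))"
      by (intro conjI prod_poly_norm_le finite_atLeastAtMost)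
    then have "(\<Prod>i=1..n. poly_norm (P i)) \<le> (2 * exp 1 * real d) ^ ?K * poly_norm (\<lambda>z. \<Prod>i=1..n. P i z)"
      and "0 \<le> poly_norm (\<lambda>z. \<Prod>i=1..n. P i z)"
      by (simp_all only: norm_eq dim flip: of_real_prod)
    moreover have "(2 * exp 1 * real d) ^ ?K \<le> (2 * (2 * exp 1 * real d)) ^ ?K / 2 powr (real n / 1)"
      by (rule power_le_double_power_div_powr) (use n_le in \<open>simp_all del: of_nat_sum\<close>)
    ultimately have "(\<Prod>i=1..n. poly_norm (P i))
        \<le> (2 * (2 * exp 1 * real d)) ^ ?K / 2 powr (real n / 1) * poly_norm (\<lambda>z. \<Prod>i=1..n. P i z)"
      by (meson mult_right_mono order_trans)
    moreover have "1 * 4 * exp 1 * real d = 2 * (2 * exp 1 * real d)" by simp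
    ultimately show ?thesis by (simp only:)
  qed
  have complex_case: "(\<Prod>i=1..n. poly_norm (Q i))
      \<le> (2 * 4 * exp 1 * real d) ^ ?K / 2 powr (real n / 2) * poly_norm (\<lambda>z. \<Prod>i=1..n. Q i z)"
    if X: "complex_banach_space scaleC" and dim: "vector_space.dim scaleC (UNIV :: 'b set) = d"
      and Q: "\<forall>i\<in>{1..n}. polynomial_of_degree scaleC (k i) (Q i)"
  proof -
    note real_dim = complex_banach_space_real_dim[OF X dim assms(1)]
    have "continuous_on UNIV (Q i)" if "i \<in> {1..n}" for i
      using Q that by (intro polynomial_of_degree_continuous) auto
    moreover have "line_polynomial (k i) (Q i)" if "i \<in> {1..n}" for i
      using Q that by (intro line_polynomial_complex[OF X]) auto
    ultimately have *: "0 \<le> poly_norm (\<lambda>z. \<Prod>i=1..n. Q i z) \<and> (\<Prod>i=1..n. poly_norm (Q i))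
        \<le> (2 * exp 1 * dim (UNIV :: 'b set)) ^ ?K * poly_norm (\<lambda>z. \<Prod>i=1..n. Q i z)"
      using real_dim(1) by (intro conjI prod_poly_norm_le finite_atLeastAtMost)
    have "(2 * exp 1 * dim (UNIV :: 'b set)) ^ ?K \<le> (4 * exp 1 * real d) ^ ?K"
    proof (rule power_mono)
      have "real (dim (UNIV :: 'b set)) \<le> 2 * real d" using real_dim(2) by linarith
      then have "2 * exp 1 * real (dim (UNIV :: 'b set)) \<le> 2 * exp 1 * (2 * real d)"
        by (intro mult_left_mono) auto
      then show "2 * exp 1 * real (dim (UNIV :: 'b set)) \<le> 4 * exp 1 * real d" by simp
    qed simp
    also have "(4 * exp 1 * real d) ^ ?K \<le> (2 * (4 * exp 1 * real d)) ^ ?K / 2 powr (real n / 2)"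
      by (rule power_le_double_power_div_powr) (use n_le in \<open>simp_all del: of_nat_sum\<close>)
    finally have "(\<Prod>i=1..n. poly_norm (Q i))
        \<le> (2 * (4 * exp 1 * real d)) ^ ?K / 2 powr (real n / 2) * poly_norm (\<lambda>z. \<Prod>i=1..n. Q i z)"
      using * by (meson mult_right_mono order_trans)
    moreover have "2 * 4 * exp 1 * real d = 2 * (4 * exp 1 * real d)" by simp
    ultimately show ?thesis by (simp only:)
  qed
  show ?thesis using real_case complex_case by blast
qed

end
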